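(* Consider the mean-field gradient quantities $\chi^{(l)},\chi_b^{(l)},\chi_w^{(l)},\chi_v^{(l)},\chi_a^{(l)}$ of a full residual network (FRN) with nonlinearity $\phi$. (1) If $\phi=\psi_1$, then for $l>m\ge0$, $$\chi_b^{(l-m)}=\Theta(1)\chi^{(l)}B^m,\quad \chi_w^{(l-m)}=\Theta(1)\chi^{(l)}B^l,\quad \chi_v^{(l-m)}=\Theta(1)\chi^{(l)}B^l,\quad \chi_a^{(l-m)}=\Theta(1)\chi^{(l)}B^m,$$ where $B=1+\sigma_v^2\sigma_w^2/2$. (2) If $\phi=\psi_\alpha$ for $\alpha<1$, then for $l>m\ge0$, with $R=\frac{\alpha^2}{(1-\alpha)(2\alpha-1)}$, $$\chi_b^{(l-m)}=\Theta(1)\chi^{(l)}\,l^R(l-m)^{-R-1},\qquad \chi_w^{(l-m)}=\Theta(1)\chi^{(l)}\,l^R(l-m)^{\frac\alpha{1-\alpha}-R},$$ $$\chi_v^{(l-m)}=\Theta(1)\chi^{(l)}\,l^R(l-m)^{\frac\alpha{1-\alpha}-R},\qquad \chi_a^{(l-m)}=\Theta(1)\chi^{(l)}\,(l/(l-m))^R.$$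
   Context: The $\alpha$-ReLU is $\psi_\alpha(x)=x^\alpha$ for $x>0$ and $\psi_\alpha(x)=0$ otherwise; its derivative is $\dot\psi_\alpha=\alpha\psi_{\alpha-1}$. Put $\mathrm V f(q)=\mathbb E[f(z)^2]$, $z\sim\mathcal N(0,q)$. An FRN of width $N$ has layers $x^{(l)}_i=\sum_jv^{(l)}_{ij}\phi(h^{(l)}_j)+x^{(l-1)}_i+a^{(l)}_i$, $h^{(l)}_i=\sum_jw^{(l)}_{ij}x^{(l-1)}_j+b^{(l)}_i$ with independent Gaussian parameters of mean $0$ and variances $\sigma_v^2/N$, $\sigma_a^2$, $\sigma_w^2/N$, $\sigma_b^2$ respectively for $v,a,w,b$. Its mean-field ($N\to\infty$) length quantities are determined by $p^{(0)}=\|x^{(0)}\|^2/N$ and, for $l\ge1$, $q^{(l)}=\sigma_w^2p^{(l-1)}+\sigma_b^2$, $p^{(l)}=\sigma_v^2\,\mathrm V\phi(q^{(l)})+\sigma_a^2+p^{(l-1)}$. The mean-field gradient quantities of a loss $E$ are $\chi^{(l)}=\langle(\partial E/\partial x_1^{(l)})^2\rangle$, $\chi_\bullet^{(l)}=\langle(\partial E/\partial \bullet_1^{(l)})^2\rangle$ for $\bullet=a,b$ and $\chi_\bullet^{(l)}=\langle(\partial E/\partial \bullet_{11}^{(l)})^2\rangle$ for $\bullet=w,v$, computed with backward weights independent of the forward ones and gradients independent of the activations of the previous layer. Whenever $\dot\phi(\zeta)^2$ has finite variance for Gaussian $\zeta$, they satisfy $$\chi^{(l-1)}=(\sigma_v^2\sigma_w^2\,\mathrm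 V\dot\phi(q^{(l)})+1)\chi^{(l)},\quad \chi_b^{(l)}=\sigma_v^2\chi^{(l)}\,\mathrm V\dot\phi(q^{(l)}),$$ $$\chi_w^{(l)}=\sigma_v^2\chi^{(l)}\,\mathrm V\dot\phi(q^{(l)})\,p^{(l-1)},\quad \chi_v^{(l)}=\chi^{(l)}\,\mathrm V\phi(q^{(l)}),\quad \chi_a^{(l)}=\chi^{(l)}.$$
   Formalization: Part (2) is stated for 1/2 < α < 1 (at α = 1/2 R is undefined, for 0 < α ≤ 1/2 Vψ̇_α is infinite, at α = 0 χ_b = 0), and σ_v > 0, σ_w > 0 and p^(0) > 0 are assumed, since the claim fails when one of them is zero. *)

theory Defs
  imports "HOL-Probability.Probability"
begin

definition psi :: "real \<Rightarrow> real \<Rightarrow> real" where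
  "psi \<alpha> x = (if x > 0 then x powr \<alpha> else 0)"

definition psi_dot :: "real \<Rightarrow> real \<Rightarrow> real" where
  "psi_dot \<alpha> x = \<alpha> * psi (\<alpha> - 1) x"

text \<open>The derivative at 0 plays no role, as 0 is a null set for every nondegenerate Gaussian.\<close>

lemma psi_has_derivative:
  assumes "x \<noteq> 0"
  shows "(psi \<alpha> has_real_derivative psi_dot \<alpha> x) (at x)"
proof (cases "x > 0")
  case True
  have "((\<lambda>x. x powr \<alpha>) has_real_derivative psi_dot \<alpha> x) (at x)"
    using True by (auto intro!: derivative_eq_intros simp: psi_dot_def psi_def)
  then show ?thesis
    by (rule has_field_derivative_transform_within_open[where S = "{0<..}"])
      (use True in \<open>auto simp: psi_def\<close>)
next
  case False
  then have "((\<lambda>x. 0) has_real_derivative psi_dot \<alpha> x) (at x)"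
    by (simp add: psi_dot_def psi_def)
  then show ?thesis
    by (rule has_field_derivative_transform_within_open[where S = "{..<0}"])
      (use False assms in \<open>auto simp: psi_def\<close>)
qed

text \<open>The second moment \<open>E [f(z)\<^sup>2]\<close> for \<open>z\<close> normal with mean \<open>0\<close> and variance \<open>q\<close>; note that
  the second parameter of \<^const>\<open>normal_density\<close> is the standard deviation. Only \<open>q > 0\<close> is
  meaningful, which is guaranteed below once the weight deviation and the input length are positive.
  The integral takes the value \<open>0\<close> if the moment is infinite; for \<open>f = psi_dot \<alpha>\<close> it
  is finite when \<open>\<alpha> > 1/2\<close>.\<close>

definition gauss_V :: "(real \<Rightarrow> real) \<Rightarrow> real \<Rightarrow> real" where
  "gauss_V f q = (LINT z|density lborel (normal_density 0 (sqrt q)). (f z)\<^sup>2)"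

text \<open>The parameters \<open>\<sigma>v \<sigma>w \<sigma>a \<sigma>b\<close> are the standard deviations of the weights and biases
  (without the factor \<open>1/N\<close> in the variances), and \<open>p0\<close> is the normalised squared length of the
  input.\<close>

primrec frn_p ::
  "(real \<Rightarrow> real) \<Rightarrow> real \<Rightarrow> real \<Rightarrow> real \<Rightarrow> real \<Rightarrow> real \<Rightarrow> nat \<Rightarrow> real" where
  "frn_p \<phi> \<sigma>v \<sigma>w \<sigma>a \<sigma>b p0 0 = p0"
| "frn_p \<phi> \<sigma>v \<sigma>w \<sigma>a \<sigma>b p0 (Suc l) =
     \<sigma>v\<^sup>2 * gauss_V \<phi> (\<sigma>w\<^sup>2 * frn_p \<phi> \<sigma>v \<sigma>w \<sigma>a \<sigma>b p0 l + \<sigma>b\<^sup>2) + \<sigma>a\<^sup>2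
     + frn_p \<phi> \<sigma>v \<sigma>w \<sigma>a \<sigma>b p0 l"

text \<open>Meaningful for \<open>l \<ge> 1\<close> only.\<close>

definition frn_q ::
  "(real \<Rightarrow> real) \<Rightarrow> real \<Rightarrow> real \<Rightarrow> real \<Rightarrow> real \<Rightarrow> real \<Rightarrow> nat \<Rightarrow> real" where
  "frn_q \<phi> \<sigma>v \<sigma>w \<sigma>a \<sigma>b p0 l = \<sigma>w\<^sup>2 * frn_p \<phi> \<sigma>v \<sigma>w \<sigma>a \<sigma>b p0 (l - 1) + \<sigma>b\<^sup>2"

text \<open>The mean-field gradient quantities of a network of depth \<open>L\<close> are the solutions of the backward
  recursion below. The loss enters only through the value at the last layer, which is
  an arbitrary nonnegative number since the quantities are mean squares. The derivative \<open>\<phi>'\<close> of the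
  nonlinearity is passed separately because it need not exist at \<open>0\<close>.\<close>

definition frn_gradients ::
  "(real \<Rightarrow> real) \<Rightarrow> (real \<Rightarrow> real) \<Rightarrow> real \<Rightarrow> real \<Rightarrow> real \<Rightarrow> real \<Rightarrow> real \<Rightarrow> nat \<Rightarrow>
   (nat \<Rightarrow> real) \<Rightarrow> (nat \<Rightarrow> real) \<Rightarrow> (nat \<Rightarrow> real) \<Rightarrow> (nat \<Rightarrow> real) \<Rightarrow> (nat \<Rightarrow> real) \<Rightarrow> bool" where
  "frn_gradients \<phi> \<phi>' \<sigma>v \<sigma>w \<sigma>a \<sigma>b p0 L chi chi_b chi_w chi_v chi_a \<longleftrightarrow>
     (let p = frn_p \<phi> \<sigma>v \<sigma>w \<sigma>a \<sigma>b p0; q = frn_q \<phi> \<sigma>v \<sigma>w \<sigma>a \<sigma>b p0 in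
      0 \<le> chi L \<and>
      (\<forall>l\<in>{1..L}.
         chi (l - 1) = (\<sigma>v\<^sup>2 * \<sigma>w\<^sup>2 * gauss_V \<phi>' (q l) + 1) * chi l \<and>
         chi_b l = \<sigma>v\<^sup>2 * chi l * gauss_V \<phi>' (q l) \<and>
         chi_w l = \<sigma>v\<^sup>2 * chi l * gauss_V \<phi>' (q l) * p (l - 1) \<and>
         chi_v l = chi l * gauss_V \<phi> (q l) \<and>
         chi_a l = chi l))"

text \<open>The relation \<open>f = \<Theta>(1) g\<close> with explicit constants, so that uniformity is visible from
  where \<open>c\<close> and \<open>C\<close> are quantified.\<close>

definition theta_with :: "real \<Rightarrow> real \<Rightarrow> real \<Rightarrow> real \<Rightarrow> bool" where
  "theta_with c C f g \<longleftrightarrow> c * g \<le> f \<and> f \<le> C * g"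

end

(* Gaussian scaling gives V psi_a(q) = c_a q^a, and integration by parts c_a = (2a - 1) c_(a-1).
   For a = 1 everything is linear. For a < 1 the lengths satisfy q' = q + A q^a + D, so that
   q^(1-a) grows linearly in the layer k. The gradient factor at layer k is
   1 + A R (1 - a) q^(a-1), whose logarithm differs from the increment of R ln (q^(1-a)) only by
   O(1 / k^2). As this is summable, the product of the factors telescopes to (l / (l - m))^R up to
   bounded factors, without any precise asymptotics of q. *)

theory Submission
  imports Defs "HOL-Real_Asymp.Real_Asymp"
begin

text \<open>The constants must serve every depth, every pair of layers and every loss at once. So
  all comparisons concern quantities of the forward pass, as functions of the pair (l - m, l), and
  \<open>chi l\<close>, which may be 0, enters only at the end as a nonnegative factor. The value of
  R comes from a ratio. With v the second moment of \<open>psi (\<alpha> - 1)\<close> at variance 1,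
  integration by parts gives the growth constant A = \<open>\<sigma>w\<^sup>2 * \<sigma>v\<^sup>2 *
  ((2 * \<alpha> - 1) * v)\<close>, while the gradient factor exceeds 1 by \<open>\<sigma>v\<^sup>2
  * \<sigma>w\<^sup>2 * (\<alpha>\<^sup>2 * v)\<close> times the same power of q. In the quotient
  the variances and v cancel, and \<alpha>^2 / (2 \<alpha> - 1) = R (1 - \<alpha>) remains. The
  threshold \<alpha> > 1/2 acts in several places: it makes the moment of the derivative finite, it
  makes the boundary term at 0 of the integration by parts vanish, and it keeps the constant
  increment D out of the leading order.\<close>

section \<open>Gaussian second moments of the \<alpha>-ReLU\<close>

lemma gauss_V_nonneg: "0 \<le> gauss_V f q"
  unfolding gauss_V_def by (rule integral_nonneg_AE) simp

lemma borel_measurable_psi [measurable]: "psi \<alpha> \<in> borel_measurable borel"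
  unfolding psi_def by measurable

lemma gauss_V_lborel:
  assumes [measurable]: "f \<in> borel_measurable borel"
  shows "gauss_V f q = (LBINT z. normal_density 0 (sqrt q) z * (f z)\<^sup>2)"
  unfolding gauss_V_def by (subst integral_real_density) auto

lemma gauss_V_psi_dot: "gauss_V (psi_dot \<alpha>) q = \<alpha>\<^sup>2 * gauss_V (psi (\<alpha> - 1)) q"
  unfolding gauss_V_def psi_dot_def by (simp add: power_mult_distrib)

text \<open>Substitute z = \<open>sqrt q * y\<close>: the square of \<open>psi \<alpha>\<close> is
  homogeneous of degree 2 \<alpha>. If the moment is infinite, both sides are 0, the default value
  of the integral.\<close>

lemma gauss_V_psi_scale:
  assumes "q > 0"
  shows "gauss_V (psi \<alpha>) q = q powr \<alpha> * gauss_V (psi \<alpha>) 1"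
proof -
  have density: "normal_density 0 (sqrt q) (sqrt q * y) = normal_density 0 1 y / sqrt q" for y
    using assms by (simp add: normal_density_def real_sqrt_mult field_simps power_mult_distrib)
  have "(psi \<alpha> (sqrt q * y))\<^sup>2 = q powr \<alpha> * (psi \<alpha> y)\<^sup>2" for y
    using assms
    by (simp add: psi_def zero_less_mult_iff powr_mult power_mult_distrib
        powr_half_sqrt[symmetric] powr_powr powr_power)
  then have "sqrt q * (normal_density 0 (sqrt q) (sqrt q * y) * (psi \<alpha> (sqrt q * y))\<^sup>2)
      = q powr \<alpha> * (normal_density 0 1 y * (psi \<alpha> y)\<^sup>2)" for y
    using assms by (simp add: density)
  then show ?thesis
    using lborel_integral_real_affine[of "sqrt q" "\<lambda>z. normal_density 0 (sqrt q) z * (psi \<alpha> z)\<^sup>2" 0]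
      assms
    by (simp add: gauss_V_lborel flip: integral_mult_right_zero)
qed

lemma gauss_V_psi_one:
  "gauss_V (psi \<alpha>) 1 = (LBINT z:{0<..}. std_normal_density z * z powr (2 * \<alpha>))"
  unfolding gauss_V_lborel[OF borel_measurable_psi] set_lebesgue_integral_def
  by (rule Bochner_Integration.integral_cong)
    (auto simp: psi_def powr_power mult.commute indicator_def)

text \<open>For negative s the integrand is singular at 0. The primitive still has a finite limit
  there because s + 1 > 0, and for a nonnegative integrand this already yields
  integrability.\<close>

lemma set_integrable_powr_unit:
  fixes s :: real
  assumes "-1 < s"
  shows "set_integrable lborel {0<..<1} (\<lambda>z. z powr s)"
proof -
  have "set_integrable lborel (einterval (ereal 0) (ereal 1)) (\<lambda>z. z powr s)"
  proof (rule interval_integral_FTC_nonneg(1)[where F = "\<lambda>z. z powr (s + 1) / (s + 1)"])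
    show "((\<lambda>z. z powr (s + 1) / (s + 1)) has_real_derivative x powr s) (at x)"
      if "ereal 0 < ereal x" "ereal x < ereal 1" for x
      using that assms by (auto intro!: derivative_eq_intros)
    show "isCont (\<lambda>z. z powr s) x"
      if "ereal 0 < ereal x" "ereal x < ereal 1" for x
      using that by (auto intro!: continuous_intros)
    have "((\<lambda>z::real. z powr (s + 1) / (s + 1)) \<longlongrightarrow> 0) (at_right 0)"
      using assms by real_asymp
    then show "(((\<lambda>z. z powr (s + 1) / (s + 1)) \<circ> real_of_ereal) \<longlongrightarrow> 0) (at_right (ereal 0))"
      by (simp add: ereal_tendsto_simps)
    have "((\<lambda>z::real. z powr (s + 1) / (s + 1)) \<longlongrightarrow> 1 / (s + 1)) (at_left 1)"
      using assms by (auto intro!: tendsto_eq_intros)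
    then show "(((\<lambda>z. z powr (s + 1) / (s + 1)) \<circ> real_of_ereal) \<longlongrightarrow> 1 / (s + 1)) (at_left (ereal 1))"
      by (simp add: ereal_tendsto_simps)
  qed auto
  then show ?thesis by simp
qed

text \<open>Split at 1. Below 1 the density is at most 1, which leaves the power alone; from 1 on,
  the power is at most \<open>z ^ 2\<close>, whose Gaussian integral is finite. The range of s
  covers both 2 \<alpha> and 2 (\<alpha> - 1) for 1/2 < \<alpha> \<le> 1.\<close>

lemma set_integrable_std_normal_powr:
  fixes s :: real
  assumes "-1 < s" and "s \<le> 2"
  shows "set_integrable lborel {0<..} (\<lambda>z. std_normal_density z * z powr s)"
proof -
  have sq: "integrable lborel (\<lambda>z. std_normal_density z * z ^ 2)"
    using integrable_std_normal_moment[of 2] by simp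
  have one: "integrable lborel (\<lambda>z. indicat_real {0<..<1} z * z powr s)"
    using set_integrable_powr_unit[OF assms(1)] by (simp add: set_integrable_def)
  have bound: "norm (indicat_real {0<..} z *\<^sub>R (std_normal_density z * z powr s))
      \<le> norm (indicat_real {0<..<1} z * z powr s + std_normal_density z * z ^ 2)" for z
  proof -
    consider "z \<le> 0" | "0 < z" "z < 1" | "1 \<le> z" by linarith
    then show ?thesis
    proof cases
      case 2
      have "std_normal_density z \<le> 1 * 1"
        unfolding std_normal_density_def
      proof (rule mult_mono)
        have "1 \<le> sqrt (2 * pi)" using pi_gt3 by (intro real_le_rsqrt) simp
        then show "1 / sqrt (2 * pi) \<le> 1" by simp
      qed auto
      then have "std_normal_density z * z powr s \<le> 1 * z powr s"
        by (intro mult_right_mono) auto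
      with 2 show ?thesis by (simp add: add_increasing2)
    next
      case 3
      then have "z powr s \<le> z powr 2" using assms by (intro powr_mono) auto
      with 3 show ?thesis by (auto simp: powr_numeral intro!: mult_left_mono)
    qed simp
  qed
  show ?thesis
    unfolding set_integrable_def
    by (rule Bochner_Integration.integrable_bound[OF Bochner_Integration.integrable_add[OF one sq]])
      (use bound in auto)
qed

text \<open>Integrability is the point: a divergent moment would have the value 0. Once it is known,
  a zero integral would force the positive integrand to vanish almost everywhere on the unit
  interval.\<close>

lemma gauss_V_psi_one_pos:
  assumes "-1/2 < \<alpha>" and "\<alpha> \<le> 1"
  shows "0 < gauss_V (psi \<alpha>) 1"
proof -
  let ?f = "\<lambda>z. indicat_real {0<..} z *\<^sub>R (std_normal_density z * z powr (2 * \<alpha>))"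
  have int: "integrable lborel ?f"
    using set_integrable_std_normal_powr[of "2 * \<alpha>"] assms by (simp add: set_integrable_def)
  have "integral\<^sup>L lborel ?f \<noteq> 0"
  proof
    assume "integral\<^sup>L lborel ?f = 0"
    then have "AE z in lborel. ?f z = 0"
      using integral_nonneg_eq_0_iff_AE[OF int] by simp
    then have "AE z in lborel. z \<notin> {0::real<..<1}"
      by eventually_elim (auto simp: indicator_def std_normal_density_def split: if_splits)
    then have "emeasure lborel {0::real<..<1} = 0"
      by (subst (asm) AE_iff_measurable[where N = "{0<..<1}"]) auto
    then show False by simp
  qed
  moreover have "0 \<le> integral\<^sup>L lborel ?f" by (intro integral_nonneg_AE) simp
  ultimately show ?thesis
    unfolding gauss_V_psi_one set_lebesgue_integral_def by linarith
qed

text \<open>Integration by parts, as the fundamental theorem for \<open>?F\<close> on the positive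
  half-line. The derivative of the density is -z times the density, which produces
  \<open>?hi\<close>; the power produces \<open>?lo\<close>. Since 2 \<alpha> - 1 > 0,
  \<open>?F\<close> tends to 0 at 0 as well as at infinity.\<close>

lemma gauss_V_psi_one_rec:
  assumes "1/2 < \<alpha>" and "\<alpha> \<le> 1"
  shows "gauss_V (psi \<alpha>) 1 = (2 * \<alpha> - 1) * gauss_V (psi (\<alpha> - 1)) 1"
proof -
  let ?lo = "\<lambda>z. std_normal_density z * z powr (2 * (\<alpha> - 1))"
  let ?hi = "\<lambda>z. std_normal_density z * z powr (2 * \<alpha>)"
  let ?F = "\<lambda>z. std_normal_density z * z powr (2 * \<alpha> - 1)"
  have lo: "set_integrable lborel {0<..} ?lo"
    using assms by (intro set_integrable_std_normal_powr) auto
  have hi: "set_integrable lborel {0<..} ?hi"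
    using assms by (intro set_integrable_std_normal_powr) auto
  have "(LBINT x=ereal 0..\<infinity>. (2 * \<alpha> - 1) * ?lo x - ?hi x) = 0 - 0"
  proof (rule interval_integral_FTC_integrable[where F = ?F])
    fix x assume "ereal 0 < ereal x"
    then have x: "0 < x" by simp
    have "x powr (2 * \<alpha>) = x * x powr (2 * \<alpha> - 1)"
      "x powr (2 * \<alpha> - 1 - 1) = x powr (2 * (\<alpha> - 1))"
      using x by (simp_all add: powr_diff algebra_simps)
    then have "(?F has_real_derivative (2 * \<alpha> - 1) * ?lo x - ?hi x) (at x)"
      unfolding std_normal_density_def using x
      by (auto intro!: derivative_eq_intros simp: field_simps)
    then show "(?F has_vector_derivative (2 * \<alpha> - 1) * ?lo x - ?hi x) (at x)"
      by (simp add: has_real_derivative_iff_has_vector_derivative)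
    show "isCont (\<lambda>x. (2 * \<alpha> - 1) * ?lo x - ?hi x) x"
      unfolding std_normal_density_def using x by (auto intro!: continuous_intros)
  next
    show "set_integrable lborel (einterval (ereal 0) \<infinity>) (\<lambda>x. (2 * \<alpha> - 1) * ?lo x - ?hi x)"
      using lo hi by (simp add: set_integral_diff)
    have "(?F \<longlongrightarrow> 0) (at_right 0)"
      unfolding std_normal_density_def using assms by real_asymp
    then show "((?F \<circ> real_of_ereal) \<longlongrightarrow> 0) (at_right (ereal 0))"
      by (simp add: ereal_tendsto_simps)
    have "(?F \<longlongrightarrow> 0) at_top"
      unfolding std_normal_density_def using assms by real_asymp
    then show "((?F \<circ> real_of_ereal) \<longlongrightarrow> 0) (at_left \<infinity>)"
      by (simp add: ereal_tendsto_simps)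
  qed simp
  then have "(LBINT x:{0<..}. (2 * \<alpha> - 1) * ?lo x - ?hi x) = 0"
    by (simp add: interval_lebesgue_integral_def)
  then have "(2 * \<alpha> - 1) * (LBINT x:{0<..}. ?lo x) - (LBINT x:{0<..}. ?hi x) = 0"
    using lo hi by (simp add: set_integral_diff)
  then show ?thesis by (simp add: gauss_V_psi_one)
qed

text \<open>\<open>psi 0\<close> is the indicator of the positive half-line, so symmetry of the
  density gives one half of the total mass.\<close>

lemma gauss_V_psi_zero: "gauss_V (psi 0) 1 = 1 / 2"
proof -
  let ?f = "\<lambda>z. indicat_real {0<..} z *\<^sub>R std_normal_density z"
  have f_int: "integrable lborel ?f"
    using set_integrable_std_normal_powr[of 0] unfolding set_integrable_def
    by (rule Bochner_Integration.integrable_cong[THEN iffD1, rotated 2]) (auto simp: indicator_def)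
  have half: "gauss_V (psi 0) 1 = integral\<^sup>L lborel ?f"
    unfolding gauss_V_psi_one set_lebesgue_integral_def
    by (rule Bochner_Integration.integral_cong) (auto simp: indicator_def)
  have refl: "integral\<^sup>L lborel ?f = (LBINT z. ?f (- z))"
    using lborel_integral_real_affine[of "-1" ?f 0] by simp
  have f_neg_int: "integrable lborel (\<lambda>z. ?f (- z))"
    using lborel_integrable_real_affine[OF f_int, of "-1" 0] by simp
  have "(LBINT z. ?f z + ?f (- z)) = (LBINT z. std_normal_density z)"
  proof (rule integral_cong_AE)
    \<comment> \<open>At z = 0 both indicators vanish, so the two integrands agree only almost
      everywhere.\<close>
    have "AE z::real in lborel. z \<noteq> 0" by (rule AE_lborel_singleton)
    then show "AE z in lborel. ?f z + ?f (- z) = std_normal_density z"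
      by eventually_elim (auto simp: indicator_def std_normal_density_def)
  qed auto
  then have "(LBINT z. ?f z + ?f (- z)) = 1" by simp
  then have "integral\<^sup>L lborel ?f + (LBINT z. ?f (- z)) = 1"
    by (subst (asm) Bochner_Integration.integral_add[OF f_int f_neg_int])
  with half refl show ?thesis by simp
qed

section \<open>Comparability up to bounded factors\<close>

text \<open>The relation \<Theta>(1), uniform on S, in logarithmic form: products, powers and
  telescoping products become sums, and constants simply add up. Positivity is included so that the
  logarithms carry information.\<close>

definition comparable_on :: "'a set \<Rightarrow> ('a \<Rightarrow> real) \<Rightarrow> ('a \<Rightarrow> real) \<Rightarrow> bool" where
  "comparable_on S f g \<longleftrightarrow>
     (\<forall>x\<in>S. 0 < f x \<and> 0 < g x) \<and> (\<exists>K. \<forall>x\<in>S. \<bar>ln (f x) - ln (g x)\<bar> \<le> K)"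

lemma comparable_on_ln_boundI:
  assumes "\<And>x. x \<in> S \<Longrightarrow> 0 < f x" and "\<And>x. x \<in> S \<Longrightarrow> 0 < g x"
    and "\<And>x. x \<in> S \<Longrightarrow> \<bar>ln (f x) - ln (g x)\<bar> \<le> K"
  shows "comparable_on S f g"
  using assms unfolding comparable_on_def by blast

lemma comparable_on_boundI:
  assumes g: "\<And>x. x \<in> S \<Longrightarrow> 0 < g x" and "0 < c"
    and lower: "\<And>x. x \<in> S \<Longrightarrow> c * g x \<le> f x" and upper: "\<And>x. x \<in> S \<Longrightarrow> f x \<le> C * g x"
  shows "comparable_on S f g"
proof (rule comparable_on_ln_boundI[OF _ g])
  fix x assume x: "x \<in> S"
  note g = g[OF x] and lower = lower[OF x] and upper = upper[OF x]
  show f: "0 < f x" using mult_pos_pos[OF \<open>0 < c\<close> g] lower by linarith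
  have C: "0 < C" using f g upper by (smt (verit) mult_nonneg_nonneg mult_le_0_iff)
  have "ln (c * g x) \<le> ln (f x)" "ln (f x) \<le> ln (C * g x)"
    using lower upper f g \<open>0 < c\<close> C by (simp_all del: ln_mult)
  then show "\<bar>ln (f x) - ln (g x)\<bar> \<le> \<bar>ln c\<bar> + \<bar>ln C\<bar>"
    using g \<open>0 < c\<close> C by (simp add: ln_mult)
qed

lemma comparable_on_sym: "comparable_on S f g \<Longrightarrow> comparable_on S g f"
  unfolding comparable_on_def by (auto simp: abs_minus_commute)

lemma comparable_on_trans [trans]:
  assumes "comparable_on S f g" and "comparable_on S g h"
  shows "comparable_on S f h"
proof -
  from assms obtain K K' where
    "\<And>x. x \<in> S \<Longrightarrow> \<bar>ln (f x) - ln (g x)\<bar> \<le> K" "\<And>x. x \<in> S \<Longrightarrow> \<bar>ln (g x) - ln (h x)\<bar> \<le> K'"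
    unfolding comparable_on_def by blast
  then show ?thesis
    using assms unfolding comparable_on_def
    by (intro conjI exI[of _ "K + K'"] ballI) (auto, smt (verit))
qed

lemma comparable_on_mult:
  assumes "comparable_on S f g" and "comparable_on S f' g'"
  shows "comparable_on S (\<lambda>x. f x * f' x) (\<lambda>x. g x * g' x)"
proof -
  from assms obtain K K' where
    "\<And>x. x \<in> S \<Longrightarrow> \<bar>ln (f x) - ln (g x)\<bar> \<le> K" "\<And>x. x \<in> S \<Longrightarrow> \<bar>ln (f' x) - ln (g' x)\<bar> \<le> K'"
    unfolding comparable_on_def by blast
  note K = this
  have pos: "0 < f x" "0 < g x" "0 < f' x" "0 < g' x" if "x \<in> S" for x
    using assms that unfolding comparable_on_def by auto
  show ?thesis
  proof (rule comparable_on_ln_boundI[where K = "K + K'"])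
    fix x assume x: "x \<in> S"
    show "\<bar>ln (f x * f' x) - ln (g x * g' x)\<bar> \<le> K + K'"
      using K[OF x] pos[OF x] by (simp add: ln_mult)
  qed (use pos in auto)
qed

lemma comparable_on_powr:
  assumes "comparable_on S f g"
  shows "comparable_on S (\<lambda>x. f x powr r) (\<lambda>x. g x powr r)"
proof -
  from assms obtain K where K: "\<And>x. x \<in> S \<Longrightarrow> \<bar>ln (f x) - ln (g x)\<bar> \<le> K"
    unfolding comparable_on_def by blast
  have pos: "0 < f x" "0 < g x" if "x \<in> S" for x
    using assms that unfolding comparable_on_def by auto
  show ?thesis
  proof (rule comparable_on_ln_boundI[where K = "\<bar>r\<bar> * K"])
    fix x assume x: "x \<in> S"
    have "\<bar>r * ln (f x) - r * ln (g x)\<bar> = \<bar>r\<bar> * \<bar>ln (f x) - ln (g x)\<bar>"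
      by (simp add: right_diff_distrib flip: abs_mult)
    then show "\<bar>ln (f x powr r) - ln (g x powr r)\<bar> \<le> \<bar>r\<bar> * K"
      using K[OF x] pos[OF x] by (simp add: ln_powr mult_left_mono)
  qed (auto dest: pos)
qed

lemma comparable_on_cong:
  assumes "comparable_on S f g" and "\<And>x. x \<in> S \<Longrightarrow> f x = f' x" and "\<And>x. x \<in> S \<Longrightarrow> g x = g' x"
  shows "comparable_on S f' g'"
  using assms unfolding comparable_on_def by auto

lemma comparable_on_divide:
  assumes "comparable_on S f g" and "comparable_on S f' g'"
  shows "comparable_on S (\<lambda>x. f x / f' x) (\<lambda>x. g x / g' x)"
proof -
  have "comparable_on S (\<lambda>x. f x * f' x powr - 1) (\<lambda>x. g x * g' x powr - 1)"
    by (intro comparable_on_mult comparable_on_powr assms)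
  then show ?thesis
    by (rule comparable_on_cong) (use assms in \<open>auto simp: comparable_on_def powr_minus_divide\<close>)
qed

lemma comparable_on_cmult:
  assumes "comparable_on S f g" and "0 < c"
  shows "comparable_on S (\<lambda>x. c * f x) g"
proof (rule comparable_on_trans[OF _ assms(1)])
  show "comparable_on S (\<lambda>x. c * f x) f"
    by (rule comparable_on_boundI[where c = c and C = c])
      (use assms in \<open>auto simp: comparable_on_def\<close>)
qed

lemma comparable_on_compose:
  assumes "comparable_on T f g" and "\<And>x. x \<in> S \<Longrightarrow> h x \<in> T"
  shows "comparable_on S (\<lambda>x. f (h x)) (\<lambda>x. g (h x))"
  using assms unfolding comparable_on_def by blast

text \<open>Allowing every sufficiently large K lets several comparisons share one pair of
  constants, by taking a maximum.\<close>

lemma comparable_on_theta_with: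
  assumes "comparable_on S f g"
  shows "\<exists>K0. \<forall>K\<ge>K0. \<forall>x\<in>S. theta_with (exp (- K)) (exp K) (f x) (g x)"
proof -
  from assms obtain K0 where K0: "\<And>x. x \<in> S \<Longrightarrow> \<bar>ln (f x) - ln (g x)\<bar> \<le> K0"
    unfolding comparable_on_def by blast
  have "theta_with (exp (- K)) (exp K) (f x) (g x)" if "K0 \<le> K" "x \<in> S" for K x
  proof -
    have pos: "0 < f x" "0 < g x" using assms that unfolding comparable_on_def by auto
    have "- K + ln (g x) \<le> ln (f x)" "ln (f x) \<le> K + ln (g x)"
      using K0[OF that(2)] that(1) by linarith+
    then have "exp (- K + ln (g x)) \<le> exp (ln (f x))" "exp (ln (f x)) \<le> exp (K + ln (g x))"
      by simp_all
    then show ?thesis using pos unfolding theta_with_def exp_add by simp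
  qed
  then show ?thesis by blast
qed

lemma comparable_on_Suc: "comparable_on {1..} (\<lambda>n. real (Suc n)) real"
  by (rule comparable_on_boundI[where c = 1 and C = 2]) auto

section \<open>Logarithm bounds and sequences with power-law increments\<close>

lemma divide_one_plus_le_ln:
  fixes x :: real
  assumes "0 \<le> x"
  shows "x / (1 + x) \<le> ln (1 + x)"
proof -
  have "ln (1 / (1 + x)) \<le> 1 / (1 + x) - 1"
    using assms by (intro ln_le_minus_one) auto
  then show ?thesis using assms by (simp add: ln_div field_simps)
qed

lemma abs_ln_one_plus_minus_le:
  fixes x :: real
  assumes "0 \<le> x"
  shows "\<bar>ln (1 + x) - x\<bar> \<le> x\<^sup>2"
proof -
  have "x - x / (1 + x) = x\<^sup>2 / (1 + x)"
    using assms by (simp add: field_simps power2_eq_square)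
  also have "\<dots> \<le> x\<^sup>2 / 1"
    using assms by (intro divide_left_mono) auto
  finally show ?thesis
    using divide_one_plus_le_ln[OF assms] ln_add_one_self_le_self[OF assms] by simp
qed

text \<open>The abstract form of the length recursion for \<open>frn_q\<close>. It starts at 1
  because the truncated subtraction in \<open>frn_q\<close> makes its value at 0 repeat the value at
  1.\<close>

locale power_growth =
  fixes Q :: "nat \<Rightarrow> real" and A D \<alpha> :: real
  assumes A_pos: "0 < A" and D_nonneg: "0 \<le> D" and \<alpha>_gt: "1/2 < \<alpha>" and \<alpha>_lt: "\<alpha> < 1"
    and Q1_pos: "0 < Q 1"
    and Q_Suc: "1 \<le> k \<Longrightarrow> Q (Suc k) = Q k + A * Q k powr \<alpha> + D"
begin

definition "rel_incr k = A * Q k powr (\<alpha> - 1) + D / Q k"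

text \<open>Enlarges A so that D is absorbed: since Q never drops below \<open>Q 1\<close>, the
  whole relative increment is at most A' times \<open>Q k powr (\<alpha> - 1)\<close>.\<close>

definition "A' = A + D * Q 1 powr (- \<alpha>)"

lemma A'_pos: "0 < A'"
  unfolding A'_def using A_pos D_nonneg by (simp add: add_pos_nonneg)

lemma Q_ge: "1 \<le> k \<Longrightarrow> Q 1 \<le> Q k"
proof (induction k rule: dec_induct)
  case (step k)
  have "0 \<le> A * Q k powr \<alpha> + D" using A_pos D_nonneg by simp
  then show ?case using step Q_Suc by simp
qed simp

lemma Q_pos: "1 \<le> k \<Longrightarrow> 0 < Q k"
  using Q_ge Q1_pos by (meson less_le_trans)

lemma Q_Suc_rel:
  assumes "1 \<le> k"
  shows "Q (Suc k) = Q k * (1 + rel_incr k)"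
proof -
  have "Q k * Q k powr (\<alpha> - 1) = Q k powr \<alpha>"
    using Q_pos[OF assms] by (simp add: powr_diff)
  then show ?thesis
    using Q_pos[OF assms] Q_Suc[OF assms] by (simp add: rel_incr_def field_simps)
qed

lemma rel_incr_ge: "1 \<le> k \<Longrightarrow> A * Q k powr (\<alpha> - 1) \<le> rel_incr k"
  unfolding rel_incr_def using D_nonneg Q_pos by (simp add: less_imp_le)

lemma rel_incr_nonneg: "1 \<le> k \<Longrightarrow> 0 \<le> rel_incr k"
  unfolding rel_incr_def using A_pos D_nonneg Q_pos[of k] by simp

text \<open>Split 1 / Q into the powers -r and r - 1 and bound the first by its value at
  \<open>Q 1\<close>. With r = \<alpha> the term D / Q is of first order in
  \<open>Q k powr (\<alpha> - 1)\<close>; with r = 2 \<alpha> - 1 it is of second order.\<close>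

lemma D_over_Q_le:
  assumes "1 \<le> k" and "0 \<le> r"
  shows "D / Q k \<le> D * Q 1 powr (- r) * Q k powr (r - 1)"
proof -
  have "D / Q k = D * (Q k powr (- r) * Q k powr (r - 1))"
  proof -
    have "Q k powr (- r) * Q k powr (r - 1) = Q k powr (- 1)" by (simp flip: powr_add)
    then show ?thesis using Q_pos[OF assms(1)] by (simp add: powr_minus_divide)
  qed
  also have "\<dots> \<le> D * (Q 1 powr (- r) * Q k powr (r - 1))"
    using assms Q_ge[OF assms(1)] Q1_pos D_nonneg
    by (intro mult_left_mono mult_right_mono powr_mono2') auto
  finally show ?thesis by (simp add: mult_ac)
qed

lemma rel_incr_le:
  assumes "1 \<le> k"
  shows "rel_incr k \<le> A' * Q k powr (\<alpha> - 1)"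
  using D_over_Q_le[OF assms, of \<alpha>] \<alpha>_gt unfolding rel_incr_def A'_def
  by (simp add: algebra_simps)

lemma Q_powr_Suc:
  assumes "1 \<le> k"
  shows "Q (Suc k) powr (1 - \<alpha>) = Q k powr (1 - \<alpha>) * (1 + rel_incr k) powr (1 - \<alpha>)"
  using assms Q_pos rel_incr_nonneg by (simp add: Q_Suc_rel powr_mult)

text \<open>As 1 - \<alpha> < 1, the growth factor of the power is at most 1 +
  \<open>rel_incr k\<close>. Multiplied by \<open>Q k powr (1 - \<alpha>)\<close>, the relative
  increment becomes an absolute gain of at most A'.\<close>

lemma Q_powr_upper:
  assumes "1 \<le> k"
  shows "Q k powr (1 - \<alpha>) \<le> (Q 1 powr (1 - \<alpha>) + A') * real k"
  using assms
proof (induction k rule: dec_induct)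
  case base
  then show ?case using A'_pos by simp
next
  case (step k)
  let ?u = "Q k powr (1 - \<alpha>)"
  have "(1 + rel_incr k) powr (1 - \<alpha>) \<le> (1 + rel_incr k) powr 1"
    using \<alpha>_gt rel_incr_nonneg[OF step(1)] by (intro powr_mono) auto
  then have "Q (Suc k) powr (1 - \<alpha>) \<le> ?u * (1 + rel_incr k)"
    using rel_incr_nonneg[OF step(1)] by (simp add: Q_powr_Suc[OF step(1)] mult_left_mono)
  also have "\<dots> \<le> ?u * (1 + A' * Q k powr (\<alpha> - 1))"
    using rel_incr_le[OF step(1)] by (intro mult_left_mono) auto
  also have "\<dots> = ?u + A' * (Q k powr (1 - \<alpha>) * Q k powr (\<alpha> - 1))"
    by (simp add: algebra_simps)
  also have "\<dots> = ?u + A'"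
    using Q_pos[OF step(1)] by (simp flip: powr_add)
  also have "\<dots> \<le> (Q 1 powr (1 - \<alpha>) + A') * real k + (Q 1 powr (1 - \<alpha>) + A')"
    using step.IH powr_ge_zero[of "Q 1" "1 - \<alpha>"] by linarith
  finally show ?case by (simp add: algebra_simps)
qed

text \<open>For an exponent below 1, Bernoulli's inequality only bounds from above. From below, (1 +
  y)^(1 - \<alpha>) = exp ((1 - \<alpha>) ln (1 + y)) is at least 1 + (1 - \<alpha>) y / (1 + y),
  and a uniform bound on y makes the resulting gain constant.\<close>

lemma Q_powr_lower:
  "\<exists>c>0. \<forall>k\<ge>1. c * real k \<le> Q k powr (1 - \<alpha>)"
proof -
  \<comment> \<open>\<open>y0\<close> is the largest possible value of \<open>?y\<close>, \<kappa>
    the guaranteed gain per step; the minimum in c also settles k = 1.\<close>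
  define y0 where "y0 = A * Q 1 powr (\<alpha> - 1)"
  define \<kappa> where "\<kappa> = (1 - \<alpha>) * A / (1 + y0)"
  define c where "c = min (Q 1 powr (1 - \<alpha>)) \<kappa>"
  have y0: "0 < y0" using A_pos Q1_pos by (simp add: y0_def)
  have "0 < c" using y0 A_pos Q1_pos \<alpha>_lt by (simp add: c_def \<kappa>_def)
  have "c * real k \<le> Q k powr (1 - \<alpha>)" if "1 \<le> k" for k
    using that
  proof (induction k rule: dec_induct)
    case base
    then show ?case by (simp add: c_def)
  next
    case (step k)
    let ?u = "Q k powr (1 - \<alpha>)" and ?y = "A * Q k powr (\<alpha> - 1)"
    have y: "0 \<le> ?y" "?y \<le> y0"
      using Q_ge[OF step(1)] Q1_pos A_pos \<alpha>_lt unfolding y0_def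
      by (auto intro!: mult_left_mono powr_mono2')
    have "?y / (1 + y0) \<le> ?y / (1 + ?y)"
      using y by (intro divide_left_mono) auto
    also have "\<dots> \<le> ln (1 + ?y)" using y by (intro divide_one_plus_le_ln)
    finally have "1 + (1 - \<alpha>) * (?y / (1 + y0)) \<le> 1 + (1 - \<alpha>) * ln (1 + ?y)"
      using \<alpha>_lt by (intro add_left_mono mult_left_mono) auto
    also have "\<dots> \<le> exp ((1 - \<alpha>) * ln (1 + ?y))" by (rule exp_ge_add_one_self)
    also have "\<dots> = (1 + ?y) powr (1 - \<alpha>)" using y by (simp add: powr_def)
    also have "\<dots> \<le> (1 + rel_incr k) powr (1 - \<alpha>)"
      using rel_incr_ge[OF step(1)] y \<alpha>_lt by (intro powr_mono2) auto
    finally have "?u * (1 + (1 - \<alpha>) * (?y / (1 + y0))) \<le> Q (Suc k) powr (1 - \<alpha>)"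
      by (simp add: Q_powr_Suc[OF step(1)] mult_left_mono)
    moreover have uy: "?u * ?y = A"
      using Q_pos[OF step(1)] by (simp add: mult.left_commute flip: powr_add)
    have "?u * (1 + (1 - \<alpha>) * (?y / (1 + y0))) = ?u + (1 - \<alpha>) * (?u * ?y) / (1 + y0)"
      by (simp only: distrib_left mult_1_right times_divide_eq_right mult_ac)
    then have "?u * (1 + (1 - \<alpha>) * (?y / (1 + y0))) = ?u + \<kappa>"
      unfolding uy \<kappa>_def .
    moreover have "c \<le> \<kappa>" by (simp add: c_def)
    moreover have "c * real (Suc k) = c * real k + c" by (simp add: distrib_left)
    ultimately show ?case using step.IH by linarith
  qed
  with \<open>0 < c\<close> show ?thesis by blast
qed

lemma comparable_Q_powr: "comparable_on {1..} (\<lambda>k. Q k powr (1 - \<alpha>)) real"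
proof -
  obtain c where "0 < c" "\<And>k. 1 \<le> k \<Longrightarrow> c * real k \<le> Q k powr (1 - \<alpha>)"
    using Q_powr_lower by blast
  then show ?thesis
    using Q_powr_upper
    by (intro comparable_on_boundI[where c = c and C = "Q 1 powr (1 - \<alpha>) + A'"]) auto
qed

text \<open>The factor \<open>A * R * (1 - \<alpha>)\<close> makes the terms of order \<open>1 / k\<close> cancel; since \<open>\<alpha> > 1/2\<close>, the
  contribution of \<open>D\<close> to \<open>rel_incr k\<close> is also of order \<open>1 / k\<^sup>2\<close> at most.\<close>

lemma ln_factor_approx:
  assumes R: "0 \<le> R"
  obtains K where "0 \<le> K"
    and "\<And>k. 1 \<le> k \<Longrightarrow>
      \<bar>ln (1 + A * R * (1 - \<alpha>) * Q k powr (\<alpha> - 1)) - R * (1 - \<alpha>) * (ln (Q (Suc k)) - ln (Q k))\<bar>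
        \<le> K / (real k)\<^sup>2"
proof -
  obtain c where c: "0 < c" "\<And>k. 1 \<le> k \<Longrightarrow> c * real k \<le> Q k powr (1 - \<alpha>)"
    using Q_powr_lower by blast
  define s where "s = R * (1 - \<alpha>)"
  \<comment> \<open>One summand for each error in units of \<open>?w\<^sup>2\<close>: linearising
    the logarithm of the gradient factor, linearising that of the growth factor, and the
    contribution of D. Dividing by \<open>c\<^sup>2\<close> then converts to the layer
    index.\<close>
  define M where "M = (A * s)\<^sup>2 + s * A'\<^sup>2 + s * (D * Q 1 powr (- (2 * \<alpha> - 1)))"
  have s: "0 \<le> s" using R \<alpha>_lt by (simp add: s_def)
  have M: "0 \<le> M" using s D_nonneg by (simp add: M_def)
  have "\<bar>ln (1 + A * s * Q k powr (\<alpha> - 1)) - s * (ln (Q (Suc k)) - ln (Q k))\<bar>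
      \<le> (M / c\<^sup>2) / (real k)\<^sup>2" if k: "1 \<le> k" for k
  proof -
    let ?w = "Q k powr (\<alpha> - 1)" and ?x = "rel_incr k"
    have x: "0 \<le> ?x" "?x \<le> A' * ?w" using rel_incr_nonneg rel_incr_le k by auto
    have w2: "?w\<^sup>2 = Q k powr (2 * \<alpha> - 1 - 1)"
      by (simp add: power2_eq_square flip: powr_add)
    have ln_Q: "ln (Q (Suc k)) - ln (Q k) = ln (1 + ?x)"
      using x Q_pos[OF k] by (simp add: Q_Suc_rel[OF k] ln_mult)
    have "0 \<le> A * s * ?w" using A_pos s by simp
    then have g: "\<bar>ln (1 + A * s * ?w) - A * s * ?w\<bar> \<le> (A * s)\<^sup>2 * ?w\<^sup>2"
      using abs_ln_one_plus_minus_le by (fastforce simp: power_mult_distrib)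
    have "\<bar>ln (1 + ?x) - ?x\<bar> \<le> ?x\<^sup>2" using x by (intro abs_ln_one_plus_minus_le)
    also have "\<dots> \<le> (A' * ?w)\<^sup>2" using x by (intro power_mono) auto
    finally have "\<bar>s * (ln (1 + ?x) - ?x)\<bar> \<le> s * (A' * ?w)\<^sup>2"
      using s by (simp add: abs_mult mult_left_mono)
    then have h: "\<bar>s * ln (1 + ?x) - s * ?x\<bar> \<le> s * A'\<^sup>2 * ?w\<^sup>2"
      by (simp add: power_mult_distrib right_diff_distrib mult.assoc)
    have "D / Q k \<le> D * Q 1 powr (- (2 * \<alpha> - 1)) * ?w\<^sup>2"
      unfolding w2 using \<alpha>_gt k by (intro D_over_Q_le) auto
    then have d: "s * (D / Q k) \<le> s * (D * Q 1 powr (- (2 * \<alpha> - 1))) * ?w\<^sup>2"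
      using mult_left_mono[OF _ s] by (fastforce simp: mult.assoc)
    have d0: "0 \<le> s * (D / Q k)"
      using s D_nonneg Q_pos[OF k] by simp
    have sx: "s * ?x = A * s * ?w + s * (D / Q k)"
      by (simp add: rel_incr_def algebra_simps)
    have "\<bar>ln (1 + A * s * ?w) - s * ln (1 + ?x)\<bar> \<le> M * ?w\<^sup>2"
      using g h d d0 sx unfolding M_def by (simp add: distrib_right)
    also have "\<dots> \<le> M * (1 / (c * real k))\<^sup>2"
    proof (intro mult_left_mono power_mono M)
      have "?w = 1 / Q k powr (1 - \<alpha>)" by (simp flip: powr_minus_divide)
      also have "\<dots> \<le> 1 / (c * real k)"
        using c k Q_pos[OF k] by (intro divide_left_mono mult_pos_pos) auto
      finally show "?w \<le> 1 / (c * real k)" .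
    qed auto
    finally show ?thesis unfolding ln_Q by (simp add: power_mult_distrib power_divide)
  qed
  moreover have "0 \<le> M / c\<^sup>2" using M by simp
  ultimately show ?thesis by (intro that) (auto simp: s_def mult.assoc)
qed

lemma comparable_prod:
  assumes R: "0 \<le> R"
  shows "comparable_on {(n, l). 1 \<le> n \<and> n \<le> l}
    (\<lambda>x. \<Prod>k\<in>{fst x<..snd x}. A * R * (1 - \<alpha>) * Q k powr (\<alpha> - 1) + 1)
    (\<lambda>x. (real (snd x) / real (fst x)) powr R)"
proof -
  let ?t = "\<lambda>k. A * R * (1 - \<alpha>) * Q k powr (\<alpha> - 1)"
  let ?P = "\<lambda>n l. \<Prod>k\<in>{n<..l}. ?t k + 1"
  let ?S = "{(n, l). 1 \<le> n \<and> n \<le> (l::nat)}"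
  obtain K where K: "0 \<le> K"
    "\<And>k. 1 \<le> k \<Longrightarrow> \<bar>ln (1 + ?t k) - R * (1 - \<alpha>) * (ln (Q (Suc k)) - ln (Q k))\<bar> \<le> K / (real k)\<^sup>2"
    using ln_factor_approx[OF R] by blast
  have t: "0 \<le> ?t k" for k using A_pos \<alpha>_lt R by simp
  have prod_pos: "0 < ?P n l" for n l
    using t by (intro prod_pos) (simp add: add_nonneg_pos)
  \<comment> \<open>The right-hand side is the telescoped form of the error sum: the error at
    \<open>Suc l\<close> is at most K (1 / l - 1 / (l + 1)).\<close>
  have bound: "\<bar>ln (?P n l) - R * (1 - \<alpha>) * (ln (Q (Suc l)) - ln (Q (Suc n)))\<bar>
      \<le> K * (1 / real n - 1 / real l)" if "1 \<le> n" "n \<le> l" for n l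
    using that(2)
  proof (induction l rule: dec_induct)
    case (step l)
    have "{n<..Suc l} = insert (Suc l) {n<..l}" using step(1) by auto
    then have "?P n (Suc l) = (1 + ?t (Suc l)) * ?P n l" by (simp add: add.commute)
    moreover have "0 < 1 + ?t (Suc l)" using t[of "Suc l"] by linarith
    ultimately have "ln (?P n (Suc l)) = ln (1 + ?t (Suc l)) + ln (?P n l)"
      using prod_pos[of n l] by (simp only: ln_mult_pos)
    moreover have "\<bar>ln (1 + ?t (Suc l)) - R * (1 - \<alpha>) * (ln (Q (Suc (Suc l))) - ln (Q (Suc l)))\<bar>
        \<le> K / (real (Suc l))\<^sup>2" by (rule K) simp
    moreover have "K / (real (Suc l))\<^sup>2 \<le> K * (1 / real l - 1 / real (Suc l))"
    proof -
      have "1 / (real (Suc l))\<^sup>2 \<le> 1 / (real l * real (Suc l))"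
        using step(1) that(1) by (intro divide_left_mono) (auto simp: power2_eq_square)
      also have "\<dots> = 1 / real l - 1 / real (Suc l)"
        using step(1) that(1) by (simp add: field_simps)
      finally show ?thesis using mult_left_mono[OF _ K(1)] by fastforce
    qed
    ultimately show ?case using step.IH by (simp add: algebra_simps)
  qed simp
  \<comment> \<open>Factor k is matched with the step from Q k to Q (k + 1), so the quotient has
    both indices shifted by one; \<open>comparable_on_Suc\<close> absorbs the shift.\<close>
  have "comparable_on ?S (\<lambda>x. ?P (fst x) (snd x))
      (\<lambda>x. (Q (Suc (snd x)) powr (1 - \<alpha>) / Q (Suc (fst x)) powr (1 - \<alpha>)) powr R)"
  proof (rule comparable_on_ln_boundI[where K = K])
    fix x assume "x \<in> ?S"
    then obtain n l where x: "x = (n, l)" "1 \<le> n" "n \<le> l" by auto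
    have Q: "0 < Q (Suc n)" "0 < Q (Suc l)" by (auto intro: Q_pos)
    then show "0 < (Q (Suc (snd x)) powr (1 - \<alpha>) / Q (Suc (fst x)) powr (1 - \<alpha>)) powr R"
      using x by simp
    have "K * (1 / real n - 1 / real l) \<le> K * 1"
      using x K by (intro mult_left_mono) (auto simp: diff_le_eq add_increasing2)
    moreover have ln_Q: "ln ((Q (Suc l) powr (1 - \<alpha>) / Q (Suc n) powr (1 - \<alpha>)) powr R)
        = R * (1 - \<alpha>) * (ln (Q (Suc l)) - ln (Q (Suc n)))"
      using Q by (simp add: ln_powr ln_div algebra_simps)
    ultimately show "\<bar>ln (?P (fst x) (snd x))
        - ln ((Q (Suc (snd x)) powr (1 - \<alpha>) / Q (Suc (fst x)) powr (1 - \<alpha>)) powr R)\<bar> \<le> K"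
      using bound[OF x(2,3)] unfolding x(1) fst_conv snd_conv ln_Q by linarith
  qed (rule prod_pos)
  also have "comparable_on ?S
      (\<lambda>x. (Q (Suc (snd x)) powr (1 - \<alpha>) / Q (Suc (fst x)) powr (1 - \<alpha>)) powr R)
      (\<lambda>x. (real (snd x) / real (fst x)) powr R)"
  proof (intro comparable_on_powr comparable_on_divide)
    have "comparable_on {1..} (\<lambda>k. Q (Suc k) powr (1 - \<alpha>)) (\<lambda>k. real (Suc k))"
      by (rule comparable_on_compose[OF comparable_Q_powr]) auto
    then have Q_Suc: "comparable_on {1..} (\<lambda>k. Q (Suc k) powr (1 - \<alpha>)) real"
      using comparable_on_Suc by (rule comparable_on_trans)
    show "comparable_on ?S (\<lambda>x. Q (Suc (snd x)) powr (1 - \<alpha>)) (\<lambda>x. real (snd x))"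
      "comparable_on ?S (\<lambda>x. Q (Suc (fst x)) powr (1 - \<alpha>)) (\<lambda>x. real (fst x))"
      by (rule comparable_on_compose[OF Q_Suc]; auto)+
  qed
  finally show ?thesis .
qed

end

section \<open>The backward recursion\<close>

lemma frn_gradients_chi:
  assumes grad: "frn_gradients \<phi> \<phi>' \<sigma>v \<sigma>w \<sigma>a \<sigma>b p0 L chi chi_b chi_w chi_v chi_a"
    and "n \<le> l" and "l \<le> L"
  shows "chi n = chi l *
      (\<Prod>k\<in>{n<..l}. \<sigma>v\<^sup>2 * \<sigma>w\<^sup>2 * gauss_V \<phi>' (frn_q \<phi> \<sigma>v \<sigma>w \<sigma>a \<sigma>b p0 k) + 1)"
    (is "_ = _ * prod ?t _")
  using assms(2,3)
proof (induction l rule: dec_induct)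
  case (step l)
  have "{n<..Suc l} = insert (Suc l) {n<..l}" using step(1) by auto
  moreover have "Suc l \<in> {1..L}" using step.prems by simp
  with grad have "chi (Suc l - 1) = ?t (Suc l) * chi (Suc l)"
    unfolding frn_gradients_def Let_def by blast
  ultimately show ?case using step by simp
qed simp

lemma frn_gradients_chi_nonneg:
  assumes grad: "frn_gradients \<phi> \<phi>' \<sigma>v \<sigma>w \<sigma>a \<sigma>b p0 L chi chi_b chi_w chi_v chi_a"
    and "l \<le> L"
  shows "0 \<le> chi l"
proof -
  have "0 \<le> chi L" using grad by (simp add: frn_gradients_def Let_def)
  then show ?thesis
    unfolding frn_gradients_chi[OF grad assms(2) order_refl]
    by (intro mult_nonneg_nonneg prod_nonneg ballI add_nonneg_nonneg gauss_V_nonneg) auto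
qed

text \<open>Reduces both cases to four comparisons of forward quantities, none of which involves the
  depth or the loss. This is why the constants can be chosen before either.\<close>

lemma frn_gradients_theta_with:
  fixes \<phi> \<phi>' :: "real \<Rightarrow> real" and \<sigma>v \<sigma>w \<sigma>a \<sigma>b p0 :: real
  defines "p \<equiv> frn_p \<phi> \<sigma>v \<sigma>w \<sigma>a \<sigma>b p0" and "q \<equiv> frn_q \<phi> \<sigma>v \<sigma>w \<sigma>a \<sigma>b p0"
  assumes "0 < \<sigma>v"
    and prod: "comparable_on {(n, l). 1 \<le> n \<and> n \<le> l}
      (\<lambda>x. \<Prod>k\<in>{fst x<..snd x}. \<sigma>v\<^sup>2 * \<sigma>w\<^sup>2 * gauss_V \<phi>' (q k) + 1) (\<lambda>x. X (fst x) (snd x))"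
    and V': "comparable_on {1..} (\<lambda>n. gauss_V \<phi>' (q n)) Y'"
    and V: "comparable_on {1..} (\<lambda>n. gauss_V \<phi> (q n)) Y"
    and p: "comparable_on {1..} (\<lambda>n. p (n - 1)) P"
  shows "\<exists>c>0. \<exists>C>0. \<forall>L chi chi_b chi_w chi_v chi_a.
    frn_gradients \<phi> \<phi>' \<sigma>v \<sigma>w \<sigma>a \<sigma>b p0 L chi chi_b chi_w chi_v chi_a \<longrightarrow>
    (\<forall>l m. m < l \<and> l \<le> L \<longrightarrow>
      theta_with c C (chi_b (l - m)) (chi l * (X (l - m) l * Y' (l - m))) \<and>
      theta_with c C (chi_w (l - m)) (chi l * (X (l - m) l * Y' (l - m) * P (l - m))) \<and>
      theta_with c C (chi_v (l - m)) (chi l * (X (l - m) l * Y (l - m))) \<and>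
      theta_with c C (chi_a (l - m)) (chi l * X (l - m) l))"
proof -
  let ?S = "{(n, l). 1 \<le> n \<and> n \<le> (l::nat)}"
  let ?t = "\<lambda>n l. \<Prod>k\<in>{n<..l}. \<sigma>v\<^sup>2 * \<sigma>w\<^sup>2 * gauss_V \<phi>' (q k) + 1"
  have fst: "comparable_on ?S (\<lambda>x. f (fst x)) (\<lambda>x. g (fst x))"
    if "comparable_on {1..} f g" for f g :: "nat \<Rightarrow> real"
    by (rule comparable_on_compose[OF that]) auto
  have sv: "0 < \<sigma>v\<^sup>2" using \<open>0 < \<sigma>v\<close> by simp
  have cb: "comparable_on ?S (\<lambda>x. \<sigma>v\<^sup>2 * (?t (fst x) (snd x) * gauss_V \<phi>' (q (fst x))))
      (\<lambda>x. X (fst x) (snd x) * Y' (fst x))"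
    by (intro comparable_on_cmult sv comparable_on_mult prod fst[OF V'])
  have cw: "comparable_on ?S
      (\<lambda>x. \<sigma>v\<^sup>2 * (?t (fst x) (snd x) * gauss_V \<phi>' (q (fst x))) * p (fst x - 1))
      (\<lambda>x. X (fst x) (snd x) * Y' (fst x) * P (fst x))"
    by (rule comparable_on_mult[OF cb fst[OF p]])
  have cv: "comparable_on ?S (\<lambda>x. ?t (fst x) (snd x) * gauss_V \<phi> (q (fst x)))
      (\<lambda>x. X (fst x) (snd x) * Y (fst x))"
    by (rule comparable_on_mult[OF prod fst[OF V]])
  obtain K1 where K1: "\<forall>K\<ge>K1. \<forall>x\<in>?S. theta_with (exp (- K)) (exp K)
       (\<sigma>v\<^sup>2 * (?t (fst x) (snd x) * gauss_V \<phi>' (q (fst x)))) (X (fst x) (snd x) * Y' (fst x))"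
    using comparable_on_theta_with[OF cb] by (elim exE) rule
  obtain K2 where K2: "\<forall>K\<ge>K2. \<forall>x\<in>?S. theta_with (exp (- K)) (exp K)
       (\<sigma>v\<^sup>2 * (?t (fst x) (snd x) * gauss_V \<phi>' (q (fst x))) * p (fst x - 1))
       (X (fst x) (snd x) * Y' (fst x) * P (fst x))"
    using comparable_on_theta_with[OF cw] by (elim exE) rule
  obtain K3 where K3: "\<forall>K\<ge>K3. \<forall>x\<in>?S. theta_with (exp (- K)) (exp K)
       (?t (fst x) (snd x) * gauss_V \<phi> (q (fst x))) (X (fst x) (snd x) * Y (fst x))"
    using comparable_on_theta_with[OF cv] by (elim exE) rule
  obtain K4 where K4: "\<forall>K\<ge>K4. \<forall>x\<in>?S. theta_with (exp (- K)) (exp K)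
       (?t (fst x) (snd x)) (X (fst x) (snd x))"
    using comparable_on_theta_with[OF prod] by (elim exE) rule
  define K where "K = max (max K1 K2) (max K3 K4)"
  have K_ge: "K1 \<le> K" "K2 \<le> K" "K3 \<le> K" "K4 \<le> K" by (auto simp: K_def)
  \<comment> \<open>The value \<open>chi l\<close> may be 0, so it is multiplied into the
    inequalities of \<open>theta_with\<close> and never into \<open>comparable_on\<close>, which
    demands positivity.\<close>
  have scale: "theta_with c C f' (z * g)" if "theta_with c C f g" "0 \<le> z" "f' = z * f"
    for c C f f' g z
    using that mult_left_mono[of "c * g" f z] mult_left_mono[of f "C * g" z]
    by (simp add: theta_with_def mult.left_commute)
  show ?thesis
  proof (rule exI[of _ "exp (- K)"], intro conjI exp_gt_zero,
      rule exI[of _ "exp K"], intro conjI exp_gt_zero allI impI; elim conjE)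
    fix L chi chi_b chi_w chi_v chi_a l m
    assume grad: "frn_gradients \<phi> \<phi>' \<sigma>v \<sigma>w \<sigma>a \<sigma>b p0 L chi chi_b chi_w chi_v chi_a"
      and ml: "m < l" "l \<le> (L::nat)"
    let ?n = "l - m"
    have mem: "(?n, l) \<in> ?S" and n: "?n \<in> {1..L}" using ml by auto
    note K = K1[rule_format, OF K_ge(1) mem] K2[rule_format, OF K_ge(2) mem]
      K3[rule_format, OF K_ge(3) mem] K4[rule_format, OF K_ge(4) mem]
    note K = K[unfolded fst_conv snd_conv]
    have pos: "0 \<le> chi l" by (rule frn_gradients_chi_nonneg[OF grad ml(2)])
    have chi: "chi ?n = chi l * ?t ?n l"
      unfolding q_def by (rule frn_gradients_chi[OF grad _ ml(2)]) simp
    have eqs: "chi_b ?n = \<sigma>v\<^sup>2 * chi ?n * gauss_V \<phi>' (q ?n)"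
      "chi_w ?n = \<sigma>v\<^sup>2 * chi ?n * gauss_V \<phi>' (q ?n) * p (?n - 1)"
      "chi_v ?n = chi ?n * gauss_V \<phi> (q ?n)"
      "chi_a ?n = chi ?n"
      using grad n unfolding frn_gradients_def Let_def p_def q_def by blast+
    show "theta_with (exp (- K)) (exp K) (chi_b ?n) (chi l * (X ?n l * Y' ?n))"
      by (rule scale[OF K(1) pos]) (simp only: eqs chi mult_ac)
    show "theta_with (exp (- K)) (exp K) (chi_w ?n) (chi l * (X ?n l * Y' ?n * P ?n))"
      by (rule scale[OF K(2) pos]) (simp only: eqs chi mult_ac)
    show "theta_with (exp (- K)) (exp K) (chi_v ?n) (chi l * (X ?n l * Y ?n))"
      by (rule scale[OF K(3) pos]) (simp only: eqs chi mult_ac)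
    show "theta_with (exp (- K)) (exp K) (chi_a ?n) (chi l * X ?n l)"
      by (rule scale[OF K(4) pos]) (simp only: eqs chi)
  qed
qed

section \<open>The forward lengths\<close>

lemma frn_p_ge: "0 < p0 \<Longrightarrow> p0 \<le> frn_p \<phi> \<sigma>v \<sigma>w \<sigma>a \<sigma>b p0 l"
proof (induction l)
  case (Suc l)
  have "0 \<le> \<sigma>v\<^sup>2 * gauss_V \<phi> (\<sigma>w\<^sup>2 * frn_p \<phi> \<sigma>v \<sigma>w \<sigma>a \<sigma>b p0 l + \<sigma>b\<^sup>2) + \<sigma>a\<^sup>2"
    by (intro add_nonneg_nonneg mult_nonneg_nonneg gauss_V_nonneg) auto
  with Suc show ?case by simp
qed simp

lemma frn_p_pos: "0 < p0 \<Longrightarrow> 0 < frn_p \<phi> \<sigma>v \<sigma>w \<sigma>a \<sigma>b p0 l"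
  by (rule less_le_trans[OF _ frn_p_ge])

lemma frn_q_pos: "0 < p0 \<Longrightarrow> 0 < \<sigma>w \<Longrightarrow> 0 < frn_q \<phi> \<sigma>v \<sigma>w \<sigma>a \<sigma>b p0 l"
  unfolding frn_q_def by (intro add_pos_nonneg mult_pos_pos frn_p_pos) auto

text \<open>Lengths never drop below p0, so the additive \<open>\<sigma>b\<^sup>2\<close> is at most
  \<open>\<sigma>b\<^sup>2 / p0\<close> times the length.\<close>

lemma comparable_frn_q_p:
  assumes "0 < p0" and "0 < \<sigma>w"
  shows "comparable_on S (frn_q \<phi> \<sigma>v \<sigma>w \<sigma>a \<sigma>b p0) (\<lambda>n. frn_p \<phi> \<sigma>v \<sigma>w \<sigma>a \<sigma>b p0 (n - 1))"
proof (rule comparable_on_boundI[where c = "\<sigma>w\<^sup>2" and C = "\<sigma>w\<^sup>2 + \<sigma>b\<^sup>2 / p0"])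
  fix n
  have "\<sigma>b\<^sup>2 / p0 * p0 \<le> \<sigma>b\<^sup>2 / p0 * frn_p \<phi> \<sigma>v \<sigma>w \<sigma>a \<sigma>b p0 (n - 1)"
    using assms frn_p_ge by (intro mult_left_mono) auto
  then show "frn_q \<phi> \<sigma>v \<sigma>w \<sigma>a \<sigma>b p0 n
      \<le> (\<sigma>w\<^sup>2 + \<sigma>b\<^sup>2 / p0) * frn_p \<phi> \<sigma>v \<sigma>w \<sigma>a \<sigma>b p0 (n - 1)"
    using assms by (simp add: frn_q_def distrib_right)
qed (use assms in \<open>auto simp: frn_q_def frn_p_pos\<close>)

text \<open>Passing from p to q makes the recursion autonomous: \<open>\<sigma>b\<^sup>2\<close>
  occurs in both consecutive values and cancels, so it influences only the starting value. The
  constant left over is the D of \<open>power_growth\<close>.\<close>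

lemma frn_q_Suc:
  assumes "1 \<le> k"
  shows "frn_q \<phi> \<sigma>v \<sigma>w \<sigma>a \<sigma>b p0 (Suc k) = frn_q \<phi> \<sigma>v \<sigma>w \<sigma>a \<sigma>b p0 k
    + \<sigma>w\<^sup>2 * \<sigma>v\<^sup>2 * gauss_V \<phi> (frn_q \<phi> \<sigma>v \<sigma>w \<sigma>a \<sigma>b p0 k) + \<sigma>w\<^sup>2 * \<sigma>a\<^sup>2"
  using assms by (cases k) (simp_all add: frn_q_def algebra_simps)

section \<open>The linear case \<alpha> = 1\<close>

lemma gauss_V_relu:
  assumes "0 < q"
  shows "gauss_V (psi 1) q = q / 2" and "gauss_V (psi_dot 1) q = 1 / 2"
proof -
  have "gauss_V (psi 1) 1 = 1 / 2"
    using gauss_V_psi_one_rec[of 1] gauss_V_psi_zero by simp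
  then show "gauss_V (psi 1) q = q / 2"
    using assms by (simp add: gauss_V_psi_scale[OF assms])
  show "gauss_V (psi_dot 1) q = 1 / 2"
    using assms by (simp add: gauss_V_psi_dot gauss_V_psi_scale[OF assms] gauss_V_psi_zero)
qed

lemma comparable_frn_p_relu:
  fixes \<sigma>v \<sigma>w \<sigma>a \<sigma>b p0 :: real
  assumes "0 < \<sigma>v" and "0 < \<sigma>w" and "0 < p0"
  shows "comparable_on UNIV (frn_p (psi 1) \<sigma>v \<sigma>w \<sigma>a \<sigma>b p0) (\<lambda>n. (1 + \<sigma>v\<^sup>2 * \<sigma>w\<^sup>2 / 2) ^ n)"
proof -
  let ?p = "frn_p (psi 1) \<sigma>v \<sigma>w \<sigma>a \<sigma>b p0"
  define s where "s = \<sigma>v\<^sup>2 * \<sigma>w\<^sup>2 / 2"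
  define d where "d = \<sigma>v\<^sup>2 * \<sigma>b\<^sup>2 / 2 + \<sigma>a\<^sup>2"
  have s: "0 < s" using assms by (simp add: s_def)
  have d: "0 \<le> d" by (simp add: d_def)
  have step: "?p (Suc n) = (1 + s) * ?p n + d" for n
    using frn_q_pos[OF assms(3,2), of "psi 1" \<sigma>v \<sigma>a \<sigma>b "Suc n"]
    by (simp add: frn_q_def gauss_V_relu s_def d_def field_simps)
  \<comment> \<open>The fixed point of the affine recursion \<open>step\<close> is - d / s, so the
    sequence shifted by d / s is geometric.\<close>
  have eq: "?p n + d / s = (p0 + d / s) * (1 + s) ^ n" for n
  proof (induction n)
    case (Suc n)
    have "?p (Suc n) + d / s = (1 + s) * (?p n + d / s)"
      using s unfolding step by (simp add: field_simps)
    then show ?case by (simp add: Suc)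
  qed simp
  have lower: "p0 * (1 + s) ^ n \<le> ?p n" for n
  proof (induction n)
    case (Suc n)
    have "(1 + s) * (p0 * (1 + s) ^ n) \<le> (1 + s) * ?p n"
      using s Suc by (intro mult_left_mono) auto
    then show ?case using d unfolding step by (simp add: mult_ac)
  qed simp
  have upper: "?p n \<le> (p0 + d / s) * (1 + s) ^ n" for n
    using eq[of n] s d by (smt (verit) divide_nonneg_pos)
  show ?thesis
    unfolding s_def[symmetric]
    by (rule comparable_on_boundI[where c = p0 and C = "p0 + d / s"])
      (use assms s lower upper in auto)
qed

lemma frn_gradients_relu:
  fixes \<sigma>v \<sigma>w \<sigma>a \<sigma>b p0 :: real
  assumes "0 < \<sigma>v" and "0 < \<sigma>w" and "0 < p0"
  shows "\<exists>c>0. \<exists>C>0. \<forall>L chi chi_b chi_w chi_v chi_a.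
        frn_gradients (psi 1) (psi_dot 1) \<sigma>v \<sigma>w \<sigma>a \<sigma>b p0 L chi chi_b chi_w chi_v chi_a \<longrightarrow>
        (\<forall>l m. m < l \<and> l \<le> L \<longrightarrow>
          (let B = 1 + \<sigma>v\<^sup>2 * \<sigma>w\<^sup>2 / 2 in
             theta_with c C (chi_b (l - m)) (chi l * B ^ m) \<and>
             theta_with c C (chi_w (l - m)) (chi l * B ^ l) \<and>
             theta_with c C (chi_v (l - m)) (chi l * B ^ l) \<and>
             theta_with c C (chi_a (l - m)) (chi l * B ^ m)))"
proof -
  let ?p = "frn_p (psi 1) \<sigma>v \<sigma>w \<sigma>a \<sigma>b p0" and ?q = "frn_q (psi 1) \<sigma>v \<sigma>w \<sigma>a \<sigma>b p0"
  define B where "B = 1 + \<sigma>v\<^sup>2 * \<sigma>w\<^sup>2 / 2"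
  have "1 < B" using assms by (simp add: B_def)
  have q: "0 < ?q k" for k by (rule frn_q_pos[OF assms(3,2)])
  have p: "comparable_on {1..} (\<lambda>n. ?p (n - 1)) (\<lambda>n. B ^ n)"
  proof (rule comparable_on_trans)
    show "comparable_on {1..} (\<lambda>n. ?p (n - 1)) (\<lambda>n. B ^ (n - 1))"
      unfolding B_def by (rule comparable_on_compose[OF comparable_frn_p_relu[OF assms]]) simp
    show "comparable_on {1..} (\<lambda>n. B ^ (n - 1)) (\<lambda>n. B ^ n)"
      by (rule comparable_on_boundI[where c = "1 / B" and C = "1 / B"])
        (use \<open>1 < B\<close> in \<open>auto simp: power_diff\<close>)
  qed
  have V: "comparable_on {1..} (\<lambda>n. gauss_V (psi 1) (?q n)) (\<lambda>n. B ^ n)"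
  proof (rule comparable_on_trans[OF _ p])
    have "comparable_on {1..} (\<lambda>n. 1 / 2 * ?q n) (\<lambda>n. ?p (n - 1))"
      by (intro comparable_on_cmult comparable_frn_q_p assms) auto
    then show "comparable_on {1..} (\<lambda>n. gauss_V (psi 1) (?q n)) (\<lambda>n. ?p (n - 1))"
      by (simp add: gauss_V_relu[OF q])
  qed
  have V': "comparable_on {1..} (\<lambda>n. gauss_V (psi_dot 1) (?q n)) (\<lambda>n. 1)"
    by (rule comparable_on_boundI[where c = "1 / 2" and C = "1 / 2"]) (auto simp: gauss_V_relu[OF q])
  \<comment> \<open>Here every gradient factor equals B, so the product is exactly a power of
    B.\<close>
  have prod: "comparable_on {(n, l). 1 \<le> n \<and> n \<le> l}
      (\<lambda>x. \<Prod>k\<in>{fst x<..snd x}. \<sigma>v\<^sup>2 * \<sigma>w\<^sup>2 * gauss_V (psi_dot 1) (?q k) + 1)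
      (\<lambda>x. B ^ (snd x - fst x))"
    by (rule comparable_on_boundI[where c = 1 and C = 1])
      (use \<open>1 < B\<close> in \<open>auto simp: gauss_V_relu[OF q] B_def add.commute\<close>)
  \<comment> \<open>The backward growth \<open>B ^ m\<close> and the forward growth
    \<open>B ^ (l - m)\<close> of the lengths multiply to \<open>B ^ l\<close>; hence the rates for
    w and v do not depend on m.\<close>
  have exps: "B ^ (l - (l - m)) * 1 = B ^ m" "B ^ (l - (l - m)) * 1 * B ^ (l - m) = B ^ l"
    "B ^ (l - (l - m)) * B ^ (l - m) = B ^ l" "B ^ (l - (l - m)) = B ^ m"
    "B ^ m * B ^ (l - m) = B ^ l" if "m < l" for l m
    using that by (auto simp flip: power_add)
  show ?thesis
    using frn_gradients_theta_with[OF assms(1) prod V' V p]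
    unfolding Let_def B_def[symmetric] by (simp add: exps cong: conj_cong imp_cong)
qed

section \<open>The case 1/2 < \<alpha> < 1\<close>

lemma frn_gradients_power:
  fixes \<sigma>v \<sigma>w \<sigma>a \<sigma>b p0 \<alpha> :: real
  assumes "0 < \<sigma>v" and "0 < \<sigma>w" and "0 < p0" and "1/2 < \<alpha>" and "\<alpha> < 1"
  shows "\<exists>c>0. \<exists>C>0. \<forall>L chi chi_b chi_w chi_v chi_a.
        frn_gradients (psi \<alpha>) (psi_dot \<alpha>) \<sigma>v \<sigma>w \<sigma>a \<sigma>b p0 L chi chi_b chi_w chi_v chi_a \<longrightarrow>
        (\<forall>l m. m < l \<and> l \<le> L \<longrightarrow>
          (let R = \<alpha>\<^sup>2 / ((1 - \<alpha>) * (2 * \<alpha> - 1)) in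
             theta_with c C (chi_b (l - m))
               (chi l * real l powr R * real (l - m) powr (- R - 1)) \<and>
             theta_with c C (chi_w (l - m))
               (chi l * real l powr R * real (l - m) powr (\<alpha> / (1 - \<alpha>) - R)) \<and>
             theta_with c C (chi_v (l - m))
               (chi l * real l powr R * real (l - m) powr (\<alpha> / (1 - \<alpha>) - R)) \<and>
             theta_with c C (chi_a (l - m))
               (chi l * (real l / real (l - m)) powr R)))"
proof -
  let ?p = "frn_p (psi \<alpha>) \<sigma>v \<sigma>w \<sigma>a \<sigma>b p0" and ?q = "frn_q (psi \<alpha>) \<sigma>v \<sigma>w \<sigma>a \<sigma>b p0"
  define R where "R = \<alpha>\<^sup>2 / ((1 - \<alpha>) * (2 * \<alpha> - 1))"
  \<comment> \<open>Both second moments, of \<open>psi \<alpha>\<close> and of its derivative, are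
    multiples of this one number.\<close>
  define v where "v = gauss_V (psi (\<alpha> - 1)) 1"
  define A where "A = \<sigma>w\<^sup>2 * \<sigma>v\<^sup>2 * ((2 * \<alpha> - 1) * v)"
  have R: "0 \<le> R" using assms by (simp add: R_def)
  have v: "0 < v" unfolding v_def using assms by (intro gauss_V_psi_one_pos) auto
  have q: "0 < ?q k" for k by (rule frn_q_pos[OF assms(3,2)])
  have V_q: "gauss_V (psi \<alpha>) (?q k) = (2 * \<alpha> - 1) * v * ?q k powr \<alpha>" for k
    using gauss_V_psi_scale[OF q] gauss_V_psi_one_rec[of \<alpha>] assms by (simp add: v_def)
  have V'_q: "gauss_V (psi_dot \<alpha>) (?q k) = \<alpha>\<^sup>2 * v * ?q k powr (\<alpha> - 1)" for k
    by (simp add: gauss_V_psi_dot gauss_V_psi_scale[OF q] v_def)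
  interpret power_growth ?q A "\<sigma>w\<^sup>2 * \<sigma>a\<^sup>2" \<alpha>
    by unfold_locales (use assms v q in \<open>auto simp: A_def frn_q_Suc V_q\<close>)
  \<comment> \<open>This identity fixes R: it turns the actual gradient factor into the form treated
    by \<open>comparable_prod\<close>.\<close>
  have AR: "A * R * (1 - \<alpha>) = \<sigma>v\<^sup>2 * \<sigma>w\<^sup>2 * (\<alpha>\<^sup>2 * v)"
    using assms by (simp add: A_def R_def)
  have prod: "comparable_on {(n, l). 1 \<le> n \<and> n \<le> l}
      (\<lambda>x. \<Prod>k\<in>{fst x<..snd x}. \<sigma>v\<^sup>2 * \<sigma>w\<^sup>2 * gauss_V (psi_dot \<alpha>) (?q k) + 1)
      (\<lambda>x. (real (snd x) / real (fst x)) powr R)"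
    using comparable_prod[OF R] unfolding AR V'_q by (simp add: mult.assoc)
  \<comment> \<open>Since q^(1 - \<alpha>) is comparable to the layer index, q itself has order 1 /
    (1 - \<alpha>); every remaining rate is a power of it.\<close>
  have q_powr: "comparable_on {1..} (\<lambda>n. ?q n powr r) (\<lambda>n. real n powr (r / (1 - \<alpha>)))" for r
    using comparable_on_powr[OF comparable_Q_powr, of "r / (1 - \<alpha>)"] assms
    by (simp add: powr_powr)
  have V: "comparable_on {1..} (\<lambda>n. gauss_V (psi \<alpha>) (?q n)) (\<lambda>n. real n powr (\<alpha> / (1 - \<alpha>)))"
    unfolding V_q using v assms by (intro comparable_on_cmult q_powr) auto
  have V': "comparable_on {1..} (\<lambda>n. gauss_V (psi_dot \<alpha>) (?q n)) (\<lambda>n. real n powr - 1)"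
  proof -
    have "(\<alpha> - 1) / (1 - \<alpha>) = - 1" using assms by (simp add: field_simps)
    then show ?thesis
      unfolding V'_q using v assms q_powr[of "\<alpha> - 1"] by (intro comparable_on_cmult) auto
  qed
  have p: "comparable_on {1..} (\<lambda>n. ?p (n - 1)) (\<lambda>n. real n powr (1 / (1 - \<alpha>)))"
  proof (rule comparable_on_trans[OF comparable_on_sym[OF comparable_frn_q_p[OF assms(3,2)]]])
    have "?q n powr 1 = ?q n" for n using q[of n] by simp
    then show "comparable_on {1..} ?q (\<lambda>n. real n powr (1 / (1 - \<alpha>)))"
      using q_powr[of 1] by simp
  qed
  \<comment> \<open>The rates for w and v coincide because 1 / (1 - \<alpha>) - 1 = \<alpha> / (1 -
    \<alpha>): the moment of the derivative times the length has the same order as the moment of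
    \<open>psi \<alpha>\<close>.\<close>
  have exps:
    "(real l / real n) powr R * real n powr - 1 = real l powr R * real n powr (- R - 1)"
    "real l powr R * real n powr (- R - 1) * real n powr (1 / (1 - \<alpha>))
      = real l powr R * real n powr (\<alpha> / (1 - \<alpha>) - R)"
    "(real l / real n) powr R * real n powr (\<alpha> / (1 - \<alpha>))
      = real l powr R * real n powr (\<alpha> / (1 - \<alpha>) - R)" for l n :: nat
  proof -
    have quot: "(real l / real n) powr R = real l powr R * real n powr (- R)"
      by (simp add: powr_divide powr_minus_divide)
    have "1 / (1 - \<alpha>) = \<alpha> / (1 - \<alpha>) + 1" using assms by (simp add: field_simps)
    then have exp: "- R - 1 + 1 / (1 - \<alpha>) = \<alpha> / (1 - \<alpha>) - R" by simp
    show "(real l / real n) powr R * real n powr - 1 = real l powr R * real n powr (- R - 1)"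
      by (simp only: quot mult.assoc powr_add[symmetric] add_uminus_conv_diff)
    show "real l powr R * real n powr (- R - 1) * real n powr (1 / (1 - \<alpha>))
        = real l powr R * real n powr (\<alpha> / (1 - \<alpha>) - R)"
      unfolding exp[symmetric] by (simp only: mult.assoc powr_add)
    show "(real l / real n) powr R * real n powr (\<alpha> / (1 - \<alpha>))
        = real l powr R * real n powr (\<alpha> / (1 - \<alpha>) - R)"
      unfolding quot by (simp add: mult.assoc flip: powr_add)
  qed
  show ?thesis
    using frn_gradients_theta_with[OF assms(1) prod V' V p]
    unfolding Let_def R_def[symmetric] exps by (simp only: mult.assoc)
qed

theorem theoremB21:
  fixes \<sigma>v \<sigma>w \<sigma>a \<sigma>b p0 :: real
  assumes "0 < \<sigma>v" and "0 < \<sigma>w" and "0 \<le> \<sigma>a" and "0 \<le> \<sigma>b" and "0 < p0"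
  shows
    "(\<exists>c>0. \<exists>C>0. \<forall>L chi chi_b chi_w chi_v chi_a.
        frn_gradients (psi 1) (psi_dot 1) \<sigma>v \<sigma>w \<sigma>a \<sigma>b p0 L chi chi_b chi_w chi_v chi_a \<longrightarrow>
        (\<forall>l m. m < l \<and> l \<le> L \<longrightarrow>
          (let B = 1 + \<sigma>v\<^sup>2 * \<sigma>w\<^sup>2 / 2 in
             theta_with c C (chi_b (l - m)) (chi l * B ^ m) \<and>
             theta_with c C (chi_w (l - m)) (chi l * B ^ l) \<and>
             theta_with c C (chi_v (l - m)) (chi l * B ^ l) \<and>
             theta_with c C (chi_a (l - m)) (chi l * B ^ m))))
     \<and>
     (\<forall>\<alpha>::real. 1/2 < \<alpha> \<and> \<alpha> < 1 \<longrightarrow>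
      (\<exists>c>0. \<exists>C>0. \<forall>L chi chi_b chi_w chi_v chi_a.
        frn_gradients (psi \<alpha>) (psi_dot \<alpha>) \<sigma>v \<sigma>w \<sigma>a \<sigma>b p0 L chi chi_b chi_w chi_v chi_a \<longrightarrow>
        (\<forall>l m. m < l \<and> l \<le> L \<longrightarrow>
          (let R = \<alpha>\<^sup>2 / ((1 - \<alpha>) * (2 * \<alpha> - 1)) in
             theta_with c C (chi_b (l - m))
               (chi l * real l powr R * real (l - m) powr (- R - 1)) \<and>
             theta_with c C (chi_w (l - m))
               (chi l * real l powr R * real (l - m) powr (\<alpha> / (1 - \<alpha>) - R)) \<and>
             theta_with c C (chi_v (l - m))
               (chi l * real l powr R * real (l - m) powr (\<alpha> / (1 - \<alpha>) - R)) \<and>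
             theta_with c C (chi_a (l - m))
               (chi l * (real l / real (l - m)) powr R)))))"
  using frn_gradients_relu[OF assms(1,2,5)] frn_gradients_power[OF assms(1,2,5)] by blast

end
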